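(* Let $G=A\rtimes B$ be a semi-direct product of groups (with $A$ normal in $G$). Then $$\gamma_2(G)=\gamma_2(A)\,[A,B]\rtimes\gamma_2(B),$$ $$\gamma_3(G)=\gamma_3(A)\,[A,B,A]\,[B,B,A]\,[A,A,B]\,[A,B,B]\rtimes\gamma_3(B).$$
   Context: $[x,y]=x^{-1}y^{-1}xy$. For subsets $P,Q\subseteq G$, $[P,Q]$ is the subgroup generated by all commutators $[p,q]$ with $p\in P$, $q\in Q$, and $[P,Q,R]=[[P,Q],R]$. $\gamma_1(G)=G$, $\gamma_{k+1}(G)=[\gamma_k(G),G]$. Juxtaposition of subgroups denotes the product of the subsets, in the displayed order. The symbol $\rtimes$ in each formula means that the displayed product of subgroups to its left lies in $A$ and forms, together with $\gamma_k(B)\le B$, an internal semi-direct decomposition of $\gamma_k(G)$. *)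

theory Defs
  imports "HOL-Algebra.Algebra"
begin

definition commutator :: "('a, 'b) monoid_scheme \<Rightarrow> 'a \<Rightarrow> 'a \<Rightarrow> 'a"
  where "commutator G x y = inv\<^bsub>G\<^esub> x \<otimes>\<^bsub>G\<^esub> inv\<^bsub>G\<^esub> y \<otimes>\<^bsub>G\<^esub> x \<otimes>\<^bsub>G\<^esub> y"

(* The library's derived_set uses x y x^-1 y^-1 and a single set, so it is not reused here. *)
definition comm2 :: "('a, 'b) monoid_scheme \<Rightarrow> 'a set \<Rightarrow> 'a set \<Rightarrow> 'a set"
  where "comm2 G P Q = generate G {commutator G p q | p q. p \<in> P \<and> q \<in> Q}"

definition comm3 :: "('a, 'b) monoid_scheme \<Rightarrow> 'a set \<Rightarrow> 'a set \<Rightarrow> 'a set \<Rightarrow> 'a set"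
  where "comm3 G P Q R = comm2 G (comm2 G P Q) R"

(* lower_central G H k is the k-th term of the lower central series of the subgroup H,
   computed inside G. Indexing starts at 1; the value at 0 is a dummy. *)
fun lower_central :: "('a, 'b) monoid_scheme \<Rightarrow> 'a set \<Rightarrow> nat \<Rightarrow> 'a set"
  where
    "lower_central G H 0 = H"
  | "lower_central G H (Suc 0) = H"
  | "lower_central G H (Suc (Suc k)) = comm2 G (lower_central G H (Suc k)) H"

(* For a subgroup H of G, "internal_semidirect (G\<lparr>carrier := H\<rparr>) N K" says that H is the
   internal semi-direct product of its normal subgroup N and its subgroup K. *)
definition internal_semidirect :: "('a, 'b) monoid_scheme \<Rightarrow> 'a set \<Rightarrow> 'a set \<Rightarrow> bool"
  where "internal_semidirect G N K \<longleftrightarrow>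
    N \<lhd> G \<and> subgroup K G \<and> N \<inter> K = {\<one>\<^bsub>G\<^esub>} \<and> N <#>\<^bsub>G\<^esub> K = carrier G"

end

theory Submission
  imports Defs
begin

text \<open>
  A subgroup \<open>K\<close> that is invariant under \<open>B\<close> need not be invariant under \<open>A\<close>, but for
  \<open>k \<in> K\<close> and \<open>a \<in> A\<close> the conjugate of \<open>k\<close> by \<open>a\<close> differs from \<open>k\<close> by an element of
  \<open>[K, A]\<close>. So \<open>PK\<close> is normal in \<open>G = AB\<close> as soon as \<open>P\<close> is normal and contains \<open>[K, A]\<close>.
  The factors of \<open>N\<close> are listed in such an order that each of them is either normal or is
  absorbed in this way by the product of the previous ones. Once \<open>N\<close> is normal, expanding
  \<open>[nc, ab]\<close> with the commutator identities shows that every generator of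
  \<open>\<gamma>\<^sub>k(G)\<close> lies in \<open>N \<gamma>\<^sub>k(B)\<close>.
\<close>

text \<open>The set of conjugators is a parameter because most factors are at first only seen to be
  invariant under \<open>B\<close>, while normality in \<open>G\<close> is assembled from invariance
  under \<open>A\<close> and under \<open>B\<close>.\<close>

definition conj_closed :: "('a, 'b) monoid_scheme \<Rightarrow> 'a set \<Rightarrow> 'a set \<Rightarrow> bool"
  where "conj_closed G H U \<longleftrightarrow> (\<forall>h\<in>H. \<forall>x\<in>U. h \<otimes>\<^bsub>G\<^esub> x \<otimes>\<^bsub>G\<^esub> inv\<^bsub>G\<^esub> h \<in> U)"

lemma set_mult_carrier_update: "N <#>\<^bsub>G\<lparr>carrier := H\<rparr>\<^esub> C = N <#>\<^bsub>G\<^esub> C"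
  by (simp add: set_mult_def)

section \<open>Commutator and conjugation identities\<close>

context group
begin

text \<open>With \<open>m_assoc\<close> and \<open>inv_mult_group\<close>, these rules reduce both
  sides of a word identity to the same freely reduced word, so the identities below are proved by
  simplification.\<close>

lemma inv_cancel_left [simp]:
  "x \<in> carrier G \<Longrightarrow> y \<in> carrier G \<Longrightarrow> x \<otimes> (inv x \<otimes> y) = y"
  "x \<in> carrier G \<Longrightarrow> y \<in> carrier G \<Longrightarrow> inv x \<otimes> (x \<otimes> y) = y"
  by (simp_all flip: m_assoc)

lemma commutator_closed [simp]:
  "x \<in> carrier G \<Longrightarrow> y \<in> carrier G \<Longrightarrow> commutator G x y \<in> carrier G"
  by (simp add: commutator_def)

lemma inv_commutator:
  "x \<in> carrier G \<Longrightarrow> y \<in> carrier G \<Longrightarrow> inv (commutator G x y) = commutator G y x"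
  by (simp add: commutator_def inv_mult_group m_assoc)

lemma commutator_mult_left:
  "x \<in> carrier G \<Longrightarrow> y \<in> carrier G \<Longrightarrow> z \<in> carrier G \<Longrightarrow>
    commutator G (x \<otimes> y) z = (inv y \<otimes> commutator G x z \<otimes> y) \<otimes> commutator G y z"
  by (simp add: commutator_def inv_mult_group m_assoc)

lemma commutator_mult_right:
  "x \<in> carrier G \<Longrightarrow> y \<in> carrier G \<Longrightarrow> z \<in> carrier G \<Longrightarrow>
    commutator G x (y \<otimes> z) = commutator G x z \<otimes> (inv z \<otimes> commutator G x y \<otimes> z)"
  by (simp add: commutator_def inv_mult_group m_assoc)

lemma conj_mult:
  "g \<in> carrier G \<Longrightarrow> x \<in> carrier G \<Longrightarrow> y \<in> carrier G \<Longrightarrow>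
    g \<otimes> (x \<otimes> y) \<otimes> inv g = (g \<otimes> x \<otimes> inv g) \<otimes> (g \<otimes> y \<otimes> inv g)"
  by (simp add: m_assoc)

lemma conj_conj:
  "a \<in> carrier G \<Longrightarrow> b \<in> carrier G \<Longrightarrow> x \<in> carrier G \<Longrightarrow>
    (a \<otimes> b) \<otimes> x \<otimes> inv (a \<otimes> b) = a \<otimes> (b \<otimes> x \<otimes> inv b) \<otimes> inv a"
  by (simp add: m_assoc inv_mult_group)

lemma conj_commutator:
  "g \<in> carrier G \<Longrightarrow> x \<in> carrier G \<Longrightarrow> y \<in> carrier G \<Longrightarrow>
    g \<otimes> commutator G x y \<otimes> inv g = commutator G (g \<otimes> x \<otimes> inv g) (g \<otimes> y \<otimes> inv g)"
  by (simp add: commutator_def m_assoc inv_mult_group)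

section \<open>Invariance under conjugation and products of subsets\<close>

lemma normal_conj: "N \<lhd> G \<Longrightarrow> x \<in> N \<Longrightarrow> g \<in> carrier G \<Longrightarrow> g \<otimes> x \<otimes> inv g \<in> N"
  by (simp add: normal.inv_op_closed2)

lemma normal_conj_closed: "N \<lhd> G \<Longrightarrow> H \<subseteq> carrier G \<Longrightarrow> conj_closed G H N"
  by (auto simp: conj_closed_def normal_conj)

lemma conj_closed_normal: "subgroup N G \<Longrightarrow> conj_closed G (carrier G) N \<Longrightarrow> N \<lhd> G"
  by (simp add: conj_closed_def normal_inv_iff)

lemma conj_closed_self: "subgroup H G \<Longrightarrow> conj_closed G H H"
  by (simp add: conj_closed_def subgroup.m_closed subgroup.m_inv_closed)

text \<open>Conjugation by \<open>a \<otimes> b\<close> is conjugation by \<open>b\<close> followed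
  by conjugation by \<open>a\<close>.\<close>

lemma conj_closed_mult:
  assumes "conj_closed G H U" "conj_closed G K U"
    and "H \<subseteq> carrier G" "K \<subseteq> carrier G" "U \<subseteq> carrier G"
  shows "conj_closed G (H <#> K) U"
proof -
  have "(a \<otimes> b) \<otimes> x \<otimes> inv (a \<otimes> b) \<in> U" if "a \<in> H" "b \<in> K" "x \<in> U" for a b x
  proof -
    have "a \<otimes> (b \<otimes> x \<otimes> inv b) \<otimes> inv a \<in> U"
      using assms(1,2) that by (simp add: conj_closed_def)
    moreover have "a \<in> carrier G" "b \<in> carrier G" "x \<in> carrier G"
      using assms(3-5) that by auto
    ultimately show ?thesis by (simp only: conj_conj)
  qed
  then show ?thesis by (auto simp: conj_closed_def set_mult_def)
qed

text \<open>Conjugation by \<open>g\<close> is a homomorphism, so it is enough to check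
  generators.\<close>

lemma conj_generate:
  assumes "S \<subseteq> carrier G" "g \<in> carrier G" "subgroup K G"
    and "\<And>s. s \<in> S \<Longrightarrow> g \<otimes> s \<otimes> inv g \<in> K"
    and "x \<in> generate G S"
  shows "g \<otimes> x \<otimes> inv g \<in> K"
  using assms(5)
proof induction
  case one
  then show ?case using assms(2,3) by (simp add: subgroup.one_closed)
next
  case (incl h)
  then show ?case by (rule assms(4))
next
  case (inv h)
  then have h: "h \<in> carrier G" using assms(1) by auto
  have "inv (g \<otimes> h \<otimes> inv g) \<in> K"
    using assms(3) assms(4)[OF inv] by (rule subgroup.m_inv_closed)
  then show ?case using h assms(2) by (simp add: inv_mult_group m_assoc)
next
  case (eng h1 h2)
  then have "h1 \<in> carrier G" "h2 \<in> carrier G"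
    using assms(1) by (auto intro: generate_in_carrier)
  then show ?case
    using eng assms(2,3) by (simp add: conj_mult subgroup.m_closed)
qed

lemma set_mult_subset_subgroup: "subgroup H G \<Longrightarrow> U \<subseteq> H \<Longrightarrow> V \<subseteq> H \<Longrightarrow> U <#> V \<subseteq> H"
  by (auto simp: set_mult_def subset_iff subgroup.m_closed)

lemma subset_set_mult_left:
  assumes "subgroup V G" "U \<subseteq> carrier G"
  shows "U \<subseteq> U <#> V"
proof
  fix x assume "x \<in> U"
  then have "x = x \<otimes> \<one>" using assms(2) by auto
  then show "x \<in> U <#> V"
    unfolding set_mult_def using \<open>x \<in> U\<close> subgroup.one_closed[OF assms(1)] by blast
qed

lemma subset_set_mult_right:
  assumes "subgroup U G" "V \<subseteq> carrier G"
  shows "V \<subseteq> U <#> V"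
proof
  fix y assume "y \<in> V"
  then have "y = \<one> \<otimes> y" using assms(2) by auto
  then show "y \<in> U <#> V"
    unfolding set_mult_def using \<open>y \<in> V\<close> subgroup.one_closed[OF assms(1)] by blast
qed

section \<open>Commutator subgroups: containment and invariance\<close>

lemma comm2_generators:
  "P \<subseteq> carrier G \<Longrightarrow> Q \<subseteq> carrier G \<Longrightarrow>
    {commutator G p q | p q. p \<in> P \<and> q \<in> Q} \<subseteq> carrier G"
  by (auto simp: subset_iff)

lemma comm2_subgroup: "P \<subseteq> carrier G \<Longrightarrow> Q \<subseteq> carrier G \<Longrightarrow> subgroup (comm2 G P Q) G"
  unfolding comm2_def by (intro generate_is_subgroup comm2_generators)

lemma commutator_in_comm2: "p \<in> P \<Longrightarrow> q \<in> Q \<Longrightarrow> commutator G p q \<in> comm2 G P Q"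
  unfolding comm2_def by (rule generate.incl) blast

text \<open>The two commutators are inverse to each other, so the order of \<open>P\<close> and
  \<open>Q\<close> does not affect the subgroup.\<close>

lemma commutator_in_comm2_swap:
  assumes "P \<subseteq> carrier G" "Q \<subseteq> carrier G" "p \<in> P" "q \<in> Q"
  shows "commutator G q p \<in> comm2 G P Q"
proof -
  have "inv (commutator G p q) \<in> comm2 G P Q"
    using comm2_subgroup[OF assms(1,2)] commutator_in_comm2[OF assms(3,4)]
    by (rule subgroup.m_inv_closed)
  then show ?thesis using assms by (simp add: inv_commutator subset_iff)
qed

lemma comm2_subset:
  assumes "subgroup H G" "\<And>p q. p \<in> P \<Longrightarrow> q \<in> Q \<Longrightarrow> commutator G p q \<in> H"
  shows "comm2 G P Q \<subseteq> H"
  unfolding comm2_def by (rule generate_subgroup_incl) (use assms in auto)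

lemma comm2_mono: "P \<subseteq> P' \<Longrightarrow> Q \<subseteq> Q' \<Longrightarrow> comm2 G P Q \<subseteq> comm2 G P' Q'"
  unfolding comm2_def by (rule mono_generate) auto

lemma comm2_subset_subgroup:
  assumes "subgroup H G" "P \<subseteq> H" "Q \<subseteq> H"
  shows "comm2 G P Q \<subseteq> H"
proof (rule comm2_subset[OF assms(1)])
  fix p q assume "p \<in> P" "q \<in> Q"
  with assms show "commutator G p q \<in> H"
    by (auto simp: commutator_def subset_iff subgroup.m_closed subgroup.m_inv_closed)
qed

text \<open>The commutator is the product of \<open>inv p\<close> and a conjugate of
  \<open>p\<close>, both in \<open>N\<close>.\<close>

lemma comm2_subset_normal_left:
  assumes "N \<lhd> G" "P \<subseteq> N" "Q \<subseteq> carrier G"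
  shows "comm2 G P Q \<subseteq> N"
proof (rule comm2_subset)
  show N: "subgroup N G" using assms(1) by (rule normal_imp_subgroup)
  fix p q assume "p \<in> P" "q \<in> Q"
  then have p: "p \<in> N" and q: "q \<in> carrier G" using assms by auto
  then have "p \<in> carrier G" using subgroup.mem_carrier[OF N] by blast
  then have "commutator G p q = inv p \<otimes> (inv q \<otimes> p \<otimes> q)"
    using q by (simp add: commutator_def m_assoc)
  moreover have "inv q \<otimes> p \<otimes> q \<in> N" using assms(1) q p by (rule normal.inv_op_closed1)
  ultimately show "commutator G p q \<in> N"
    using N p by (simp add: subgroup.m_closed subgroup.m_inv_closed)
qed

text \<open>Conjugation maps \<open>[p,q]\<close> to the commutator of the conjugates, which is
  again a generator.\<close>

lemma conj_closed_comm2: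
  assumes "H \<subseteq> carrier G" "P \<subseteq> carrier G" "Q \<subseteq> carrier G"
    and "conj_closed G H P" "conj_closed G H Q"
  shows "conj_closed G H (comm2 G P Q)"
  unfolding conj_closed_def
proof (intro ballI)
  fix h x assume h: "h \<in> H" and x: "x \<in> comm2 G P Q"
  show "h \<otimes> x \<otimes> inv h \<in> comm2 G P Q"
  proof (rule conj_generate[OF comm2_generators[OF assms(2,3)] _ comm2_subgroup[OF assms(2,3)]])
    show "h \<in> carrier G" using h assms(1) by auto
    show "x \<in> generate G {commutator G p q |p q. p \<in> P \<and> q \<in> Q}"
      using x by (simp add: comm2_def)
    fix s assume "s \<in> {commutator G p q |p q. p \<in> P \<and> q \<in> Q}"
    then obtain p q where "s = commutator G p q" "p \<in> P" "q \<in> Q" by blast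
    then show "h \<otimes> s \<otimes> inv h \<in> comm2 G P Q"
      using h assms by (auto simp: subset_iff conj_commutator conj_closed_def intro!: commutator_in_comm2)
  qed
qed

lemma comm2_normal:
  assumes "P \<lhd> G" "Q \<lhd> G"
  shows "comm2 G P Q \<lhd> G"
proof -
  have PQ: "P \<subseteq> carrier G" "Q \<subseteq> carrier G"
    using assms by (auto dest!: normal_imp_subgroup subgroup.mem_carrier)
  then have "conj_closed G (carrier G) (comm2 G P Q)"
    using assms by (intro conj_closed_comm2 normal_conj_closed) auto
  with comm2_subgroup[OF PQ] show ?thesis by (rule conj_closed_normal)
qed

text \<open>No invariance of \<open>Q\<close> is assumed: solving the expansion of
  \<open>[p h^-1, q]\<close> for the conjugate of \<open>[p,q]\<close> by \<open>h\<close> leaves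
  only commutators with left entry in \<open>P\<close>. This handles \<open>[A,B]\<close>, where
  \<open>B\<close> need not be invariant under \<open>A\<close>.\<close>

lemma conj_closed_comm2_left:
  assumes "subgroup P G" "Q \<subseteq> carrier G"
  shows "conj_closed G P (comm2 G P Q)"
  unfolding conj_closed_def
proof (intro ballI)
  have P: "P \<subseteq> carrier G" using assms(1) by (rule subgroup.subset)
  note sub = comm2_subgroup[OF P assms(2)]
  fix h x assume h: "h \<in> P" and x: "x \<in> comm2 G P Q"
  show "h \<otimes> x \<otimes> inv h \<in> comm2 G P Q"
  proof (rule conj_generate[OF comm2_generators[OF P assms(2)] _ sub])
    show "h \<in> carrier G" using h P by auto
    show "x \<in> generate G {commutator G p q |p q. p \<in> P \<and> q \<in> Q}"
      using x by (simp add: comm2_def)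
    fix s assume "s \<in> {commutator G p q |p q. p \<in> P \<and> q \<in> Q}"
    then obtain p q where s: "s = commutator G p q" and pq: "p \<in> P" "q \<in> Q" by blast
    have G: "h \<in> carrier G" "p \<in> carrier G" "q \<in> carrier G" using h pq P assms(2) by auto
    have "h \<otimes> s \<otimes> inv h = commutator G (p \<otimes> inv h) q \<otimes> inv (commutator G (inv h) q)"
      using G by (simp add: s commutator_mult_left m_assoc)
    moreover have "p \<otimes> inv h \<in> P" "inv h \<in> P"
      using assms(1) h pq by (simp_all add: subgroup.m_closed subgroup.m_inv_closed)
    ultimately show "h \<otimes> s \<otimes> inv h \<in> comm2 G P Q"
      using sub pq by (simp add: subgroup.m_closed subgroup.m_inv_closed commutator_in_comm2)
  qed
qed

section \<open>Normal products and commutators of products\<close>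

lemma normal_set_mult_absorb:
  assumes P: "P \<lhd> G" and K: "subgroup K G" and A: "subgroup A G" and B: "B \<subseteq> carrier G"
    and AB: "A <#> B = carrier G" and KB: "conj_closed G B K" and KA: "comm2 G K A \<subseteq> P"
  shows "P <#> K \<lhd> G"
proof (rule normal_invI)
  show sub: "subgroup (P <#> K) G" using P K by (rule mult_norm_subgroup)
  have Pc: "P \<subseteq> carrier G" and Kc: "K \<subseteq> carrier G" and Ac: "A \<subseteq> carrier G"
    using normal_imp_subgroup[OF P] K A by (auto dest: subgroup.mem_carrier)
  fix g h assume g: "g \<in> carrier G" and "h \<in> P <#> K"
  then obtain p k where h: "h = p \<otimes> k" and p: "p \<in> P" and k: "k \<in> K"
    by (auto simp: set_mult_def)
  obtain a b where gab: "g = a \<otimes> b" and a: "a \<in> A" and b: "b \<in> B"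
    using g unfolding AB[symmetric] set_mult_def by blast
  define k' where "k' = b \<otimes> k \<otimes> inv b"
  have k': "k' \<in> K" using KB b k by (simp add: k'_def conj_closed_def)
  have G: "p \<in> carrier G" "k \<in> carrier G" "a \<in> carrier G" "b \<in> carrier G" "k' \<in> carrier G"
    using Pc Kc Ac B p k a b k' by auto
  have "commutator G (inv a) (inv k') \<in> comm2 G K A"
    using commutator_in_comm2_swap[OF Kc Ac] a k' A K by (simp add: subgroup.m_inv_closed)
  then have c: "commutator G (inv a) (inv k') \<in> P" using KA by auto
  \<comment> \<open>Conjugation by \<open>b\<close> moves \<open>k\<close> to \<open>k'\<close>
    inside \<open>K\<close>; then \<open>a k' a^-1 = [a^-1, k'^-1] k'\<close>, and the commutator
    lies in \<open>[K,A]\<close>, hence in \<open>P\<close>.\<close>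
  have "g \<otimes> k \<otimes> inv g = commutator G (inv a) (inv k') \<otimes> k'"
    using G by (simp add: gab conj_conj flip: k'_def) (simp add: commutator_def m_assoc)
  moreover have "g \<otimes> h \<otimes> inv g = (g \<otimes> p \<otimes> inv g) \<otimes> (g \<otimes> k \<otimes> inv g)"
    using G g by (simp only: h conj_mult)
  ultimately have "g \<otimes> h \<otimes> inv g =
      ((g \<otimes> p \<otimes> inv g) \<otimes> commutator G (inv a) (inv k')) \<otimes> k'"
    \<comment> \<open>Cancelling \<open>inv g\<close> against \<open>g\<close> would destroy the
      conjugate of \<open>k\<close> that is to be rewritten.\<close>
    using G g by (simp add: m_assoc del: inv_cancel_left)
  moreover have "(g \<otimes> p \<otimes> inv g) \<otimes> commutator G (inv a) (inv k') \<in> P"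
    using normal_conj[OF P p g] c by (rule subgroup.m_closed[OF normal_imp_subgroup[OF P]])
  ultimately show "g \<otimes> h \<otimes> inv g \<in> P <#> K"
    using k' unfolding set_mult_def by blast
qed

text \<open>In \<open>G/N\<close>, the elements commuting with the image of \<open>z\<close> are
  closed under products.\<close>

lemma commutator_mult_left_normal:
  assumes "N \<lhd> G" "x \<in> carrier G" "y \<in> carrier G" "z \<in> carrier G"
    and "commutator G x z \<in> N" "commutator G y z \<in> N"
  shows "commutator G (x \<otimes> y) z \<in> N"
  using assms
  by (simp add: commutator_mult_left subgroup.m_closed[OF normal_imp_subgroup] normal.inv_op_closed1)

lemma commutator_mult_right_normal:
  assumes "N \<lhd> G" "x \<in> carrier G" "y \<in> carrier G" "z \<in> carrier G"
    and "commutator G x y \<in> N" "commutator G x z \<in> N"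
  shows "commutator G x (y \<otimes> z) \<in> N"
  using assms
  by (simp add: commutator_mult_right subgroup.m_closed[OF normal_imp_subgroup] normal.inv_op_closed1)

text \<open>The expansion is \<open>[xy,ab] = [x,ab]^y [y,b] [y,a]^b\<close>. Only
  \<open>[y,b]\<close> stays unconjugated, so \<open>C\<close> need not be normal; the conjugated
  factors lie in the normal subgroup \<open>N\<close>.\<close>

lemma comm2_set_mult_subset:
  assumes N: "N \<lhd> G" and C: "subgroup C G"
    and cl: "U \<subseteq> carrier G" "V \<subseteq> carrier G" "A \<subseteq> carrier G" "B \<subseteq> carrier G"
    and UA: "\<And>x a. x \<in> U \<Longrightarrow> a \<in> A \<Longrightarrow> commutator G x a \<in> N"
    and UB: "\<And>x b. x \<in> U \<Longrightarrow> b \<in> B \<Longrightarrow> commutator G x b \<in> N"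
    and VA: "\<And>y a. y \<in> V \<Longrightarrow> a \<in> A \<Longrightarrow> commutator G y a \<in> N"
    and VB: "\<And>y b. y \<in> V \<Longrightarrow> b \<in> B \<Longrightarrow> commutator G y b \<in> C"
  shows "comm2 G (U <#> V) (A <#> B) \<subseteq> N <#> C"
proof (rule comm2_subset)
  show sub: "subgroup (N <#> C) G" using N C by (rule mult_norm_subgroup)
  have NC: "N \<subseteq> N <#> C" "C \<subseteq> N <#> C"
    using subset_set_mult_left[OF C] subset_set_mult_right[OF normal_imp_subgroup[OF N]]
      subgroup.subset[OF C] subgroup.subset[OF normal_imp_subgroup[OF N]] by auto
  fix p q assume "p \<in> U <#> V" "q \<in> A <#> B"
  then obtain x y a b where pq: "p = x \<otimes> y" "q = a \<otimes> b"
    and m: "x \<in> U" "y \<in> V" "a \<in> A" "b \<in> B"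
    by (auto simp: set_mult_def)
  then have G: "x \<in> carrier G" "y \<in> carrier G" "a \<in> carrier G" "b \<in> carrier G"
    using cl by auto
  have "commutator G x (a \<otimes> b) \<in> N"
    using N G UA[OF m(1,3)] UB[OF m(1,4)] by (intro commutator_mult_right_normal)
  then have 1: "inv y \<otimes> commutator G x (a \<otimes> b) \<otimes> y \<in> N <#> C"
    using normal.inv_op_closed1[OF N G(2)] NC by auto
  have 2: "commutator G y b \<in> N <#> C" "inv b \<otimes> commutator G y a \<otimes> b \<in> N <#> C"
    using normal.inv_op_closed1[OF N G(4) VA[OF m(2,3)]] VB[OF m(2,4)] NC by auto
  have "commutator G y (a \<otimes> b) \<in> N <#> C"
    using 2 G by (simp add: commutator_mult_right subgroup.m_closed[OF sub])
  then show "commutator G p q \<in> N <#> C"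
    using 1 G by (simp add: pq commutator_mult_left subgroup.m_closed[OF sub])
qed

text \<open>Trivial intersection is inherited from \<open>A\<close> and \<open>B\<close>, which
  reduces each decomposition to normality of \<open>N\<close> and inclusions.\<close>

lemma internal_semidirect_subgroup:
  assumes A: "internal_semidirect G A B" and H: "subgroup H G" and N: "N \<lhd> G"
    and C: "subgroup C G"
    and sub: "N \<subseteq> A" "C \<subseteq> B" "N \<subseteq> H" "C \<subseteq> H" "H \<subseteq> N <#> C"
  shows "internal_semidirect (G\<lparr>carrier := H\<rparr>) N C"
proof -
  have "N \<inter> C = {\<one>}"
    using A sub(1,2) subgroup.one_closed[OF C] subgroup.one_closed[OF normal_imp_subgroup[OF N]]
    by (auto simp: internal_semidirect_def)
  moreover have "N <#> C = H"
    using set_mult_subset_subgroup[OF H sub(3,4)] sub(5) by auto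
  ultimately show ?thesis
    using normal_restrict_supergroup[OF H N sub(3)] subgroup_incl[OF C H sub(4)]
    by (simp add: internal_semidirect_def set_mult_carrier_update)
qed

end

section \<open>Lower central terms of a semi-direct product\<close>

lemma lower_central_2: "lower_central G H 2 = comm2 G H H"
  by (simp add: numeral_2_eq_2)

lemma lower_central_3: "lower_central G H 3 = comm3 G H H H"
  by (simp add: numeral_3_eq_3 comm3_def)

theorem proposition4p5:
  fixes G :: "('a, 'b) monoid_scheme" (structure) and A B :: "'a set"
  assumes "group G"
    and "internal_semidirect G A B"
  shows
    "(let N = lower_central G A 2 <#> comm2 G A B
      in N \<subseteq> A
         \<and> lower_central G B 2 \<subseteq> B
         \<and> internal_semidirect (G\<lparr>carrier := lower_central G (carrier G) 2\<rparr>)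
             N (lower_central G B 2))
     \<and>
     (let N = lower_central G A 3 <#> comm3 G A B A <#> comm3 G B B A
                <#> comm3 G A A B <#> comm3 G A B B
      in N \<subseteq> A
         \<and> lower_central G B 3 \<subseteq> B
         \<and> internal_semidirect (G\<lparr>carrier := lower_central G (carrier G) 3\<rparr>)
             N (lower_central G B 3))"
proof -
  interpret group G by fact
  have A: "A \<lhd> G" and B: "subgroup B G" and AB: "A <#> B = carrier G"
    using assms(2) by (auto simp: internal_semidirect_def)
  have sA: "subgroup A G" using A by (rule normal_imp_subgroup)
  have Ac [simp]: "A \<subseteq> carrier G" and Bc [simp]: "B \<subseteq> carrier G"
    using sA B by (auto dest: subgroup.mem_carrier)
  have comm_carrier [simp]: "comm2 G P Q \<subseteq> carrier G"
    if "P \<subseteq> carrier G" "Q \<subseteq> carrier G" for P Q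
    using comm2_subgroup[OF that] by (rule subgroup.subset)
  define AA where "AA = comm2 G A A"
  define D where "D = comm2 G A B"
  define BB where "BB = comm2 G B B"
  have [simp]: "AA \<subseteq> carrier G" "D \<subseteq> carrier G" "BB \<subseteq> carrier G"
    by (simp_all add: AA_def D_def BB_def)
  have sAA: "subgroup AA G" and sD: "subgroup D G" and sBB: "subgroup BB G"
    by (simp_all add: AA_def D_def BB_def comm2_subgroup)
  have AA: "AA \<lhd> G" unfolding AA_def using A A by (rule comm2_normal)
  have AB_conj: "conj_closed G B A" using A Bc by (rule normal_conj_closed)
  have BB_conj: "conj_closed G B BB"
    unfolding BB_def by (intro conj_closed_comm2 conj_closed_self B) simp_all
  have D: "D \<lhd> G"
  proof (rule conj_closed_normal[OF sD])
    \<comment> \<open>\<open>A\<close> is the left entry of \<open>[A,B]\<close>, so it normalises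
      it although \<open>B\<close> may move under \<open>A\<close>.\<close>
    have "conj_closed G A D"
      unfolding D_def using sA Bc by (rule conj_closed_comm2_left)
    moreover have "conj_closed G B D"
      unfolding D_def by (intro conj_closed_comm2 conj_closed_self AB_conj B) simp_all
    ultimately have "conj_closed G (A <#> B) D" by (rule conj_closed_mult) simp_all
    then show "conj_closed G (carrier G) D" by (simp only: AB)
  qed
  have AA_A: "AA \<subseteq> A" and DA: "D \<subseteq> A" and BB_B: "BB \<subseteq> B"
    unfolding AA_def D_def BB_def
    using comm2_subset_normal_left[OF A] comm2_subset_subgroup[OF B] by auto

  \<comment> \<open>The second term\<close>
  define N2 where "N2 = AA <#> D"
  have N2: "N2 \<lhd> G"
    unfolding N2_def using AA D by (rule normal_subgroup_set_mult_closed)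
  have N2c [simp]: "N2 \<subseteq> carrier G"
    using N2 by (auto dest!: normal_imp_subgroup subgroup.mem_carrier)
  have N2A: "N2 \<subseteq> A" unfolding N2_def using sA AA_A DA by (rule set_mult_subset_subgroup)
  have in_N2: "AA \<subseteq> N2" "D \<subseteq> N2"
    unfolding N2_def by (simp_all add: subset_set_mult_left subset_set_mult_right sD sAA)
  let ?G2 = "comm2 G (carrier G) (carrier G)"
  have sG2: "subgroup ?G2 G" by (simp add: comm2_subgroup)
  have N2G: "N2 \<subseteq> ?G2"
    unfolding N2_def AA_def D_def
    by (intro set_mult_subset_subgroup sG2 comm2_mono) simp_all
  have BBG: "BB \<subseteq> ?G2" unfolding BB_def by (intro comm2_mono) simp_all
  have "comm2 G (A <#> B) (A <#> B) \<subseteq> N2 <#> BB"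
  proof (rule comm2_set_mult_subset[OF N2 sBB])
    show "commutator G a a' \<in> N2" if "a \<in> A" "a' \<in> A" for a a'
      using commutator_in_comm2[OF that] in_N2 by (auto simp: AA_def)
    show "commutator G a b \<in> N2" if "a \<in> A" "b \<in> B" for a b
      using commutator_in_comm2[OF that] in_N2 by (auto simp: D_def)
    show "commutator G b a \<in> N2" if "b \<in> B" "a \<in> A" for a b
      using commutator_in_comm2_swap[OF Ac Bc that(2,1)] in_N2 by (auto simp: D_def)
    show "commutator G b b' \<in> BB" if "b \<in> B" "b' \<in> B" for b b'
      using commutator_in_comm2[OF that] by (simp add: BB_def)
  qed simp_all
  then have G2: "?G2 \<subseteq> N2 <#> BB" by (simp only: AB)
  have 1: "internal_semidirect (G\<lparr>carrier := ?G2\<rparr>) N2 BB"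
    by (rule internal_semidirect_subgroup[OF assms(2) sG2 N2 sBB N2A BB_B N2G BBG G2])

  \<comment> \<open>The third term\<close>
  define P1 where "P1 = comm2 G AA A"
  define P2 where "P2 = comm2 G D A"
  define P3 where "P3 = comm2 G BB A"
  define P4 where "P4 = comm2 G AA B"
  define P5 where "P5 = comm2 G D B"
  define BBB where "BBB = comm2 G BB B"
  have sP: "subgroup P1 G" "subgroup P2 G" "subgroup P3 G" "subgroup P4 G" "subgroup P5 G"
    and sBBB: "subgroup BBB G"
    by (simp_all add: P1_def P2_def P3_def P4_def P5_def BBB_def comm2_subgroup)
  have Pc [simp]: "P1 \<subseteq> carrier G" "P2 \<subseteq> carrier G" "P3 \<subseteq> carrier G" "P4 \<subseteq> carrier G"
      "P5 \<subseteq> carrier G"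
    using sP by (simp_all add: subgroup.subset)
  have mult_carrier [simp]: "U <#> V \<subseteq> carrier G" if "U \<subseteq> carrier G" "V \<subseteq> carrier G" for U V
    using that by (rule setmult_subset_G)
  \<comment> \<open>The inclusions of \<open>P3\<close> and \<open>P5\<close> in \<open>D\<close>
    and of \<open>P4\<close> in \<open>AA\<close> make absorption work: they put
    \<open>[P3,A]\<close> and \<open>[P5,A]\<close> into \<open>P2\<close>, and
    \<open>[P4,A]\<close> into \<open>P1\<close>.\<close>
  have P3D: "P3 \<subseteq> D"
  proof -
    have "P3 \<subseteq> comm2 G B A" unfolding P3_def using BB_B by (rule comm2_mono) simp
    also have "\<dots> \<subseteq> D"
      by (rule comm2_subset[OF sD]) (simp add: D_def commutator_in_comm2_swap)
    finally show ?thesis .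
  qed
  have P4AA: "P4 \<subseteq> AA" unfolding P4_def by (rule comm2_subset_normal_left[OF AA]) simp_all
  have P5D: "P5 \<subseteq> D" unfolding P5_def by (rule comm2_subset_normal_left[OF D]) simp_all
  have Pconj: "conj_closed G B P3" "conj_closed G B P4" "conj_closed G B P5"
    unfolding P3_def P4_def P5_def
    by (intro conj_closed_comm2 BB_conj AB_conj conj_closed_self[OF B]
        normal_conj_closed AA D; simp)+
  note absorb = normal_set_mult_absorb[OF _ _ sA Bc AB]
  note left = subset_set_mult_left and right = subset_set_mult_right

  \<comment> \<open>\<open>P1\<close> and \<open>P2\<close> are normal as commutators of normal
    subgroups; \<open>P3\<close>, \<open>P4\<close> and \<open>P5\<close> are then absorbed one at a
    time.\<close>
  have M2: "P1 <#> P2 \<lhd> G"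
    unfolding P1_def P2_def by (intro normal_subgroup_set_mult_closed comm2_normal AA D A)
  have P1M2: "P1 \<subseteq> P1 <#> P2" and P2M2: "P2 \<subseteq> P1 <#> P2"
    by (rule left right; simp add: sP)+
  have M23: "P1 <#> P2 \<subseteq> P1 <#> P2 <#> P3" by (rule left) (simp_all add: sP)
  have M34: "P1 <#> P2 <#> P3 \<subseteq> P1 <#> P2 <#> P3 <#> P4" by (rule left) (simp_all add: sP)
  have "comm2 G P3 A \<subseteq> P2" unfolding P2_def using P3D by (rule comm2_mono) simp
  then have M3: "P1 <#> P2 <#> P3 \<lhd> G"
    using P2M2 by (intro absorb M2 sP Pconj) auto
  have "comm2 G P4 A \<subseteq> P1" unfolding P1_def using P4AA by (rule comm2_mono) simp
  then have M4: "P1 <#> P2 <#> P3 <#> P4 \<lhd> G"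
    using P1M2 M23 by (intro absorb M3 sP Pconj) auto
  define N3 where "N3 = P1 <#> P2 <#> P3 <#> P4 <#> P5"
  have "comm2 G P5 A \<subseteq> P2" unfolding P2_def using P5D by (rule comm2_mono) simp
  then have N3: "N3 \<lhd> G"
    unfolding N3_def using P2M2 M23 M34 by (intro absorb M4 sP Pconj) auto
  have M4N: "P1 <#> P2 <#> P3 <#> P4 \<subseteq> N3"
    unfolding N3_def by (rule left) (simp_all add: sP)
  \<comment> \<open>The last factor embeds because the partial product before it contains the
    identity, being a subgroup by its normality.\<close>
  have "P3 \<subseteq> P1 <#> P2 <#> P3"
    by (rule right) (simp_all add: normal_imp_subgroup M2)
  moreover have "P4 \<subseteq> P1 <#> P2 <#> P3 <#> P4"
    by (rule right) (simp_all add: normal_imp_subgroup M3)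
  moreover have "P5 \<subseteq> N3"
    unfolding N3_def by (rule right) (simp_all add: normal_imp_subgroup M4)
  ultimately have in_N3: "P1 \<subseteq> N3" "P2 \<subseteq> N3" "P3 \<subseteq> N3" "P4 \<subseteq> N3" "P5 \<subseteq> N3"
    using M4N M34 M23 P1M2 P2M2 by auto
  have P1A: "P1 \<subseteq> A" and P2A: "P2 \<subseteq> A"
    unfolding P1_def P2_def by (rule comm2_subset_normal_left[OF A]; simp add: AA_A DA)+
  have N3A: "N3 \<subseteq> A"
    unfolding N3_def
    by (intro set_mult_subset_subgroup[OF sA] P1A P2A
        order_trans[OF P3D DA] order_trans[OF P4AA AA_A] order_trans[OF P5D DA])
  let ?G3 = "comm3 G (carrier G) (carrier G) (carrier G)"
  have sG3: "subgroup ?G3 G" by (simp add: comm3_def comm2_subgroup)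
  have N3G: "N3 \<subseteq> ?G3" and BBBG: "BBB \<subseteq> ?G3"
    unfolding N3_def P1_def P2_def P3_def P4_def P5_def BBB_def AA_def D_def BB_def comm3_def
    by (intro set_mult_subset_subgroup sG3[unfolded comm3_def] comm2_mono; simp)+
  have BBB_B: "BBB \<subseteq> B"
    unfolding BBB_def using B BB_B order_refl by (rule comm2_subset_subgroup)
  \<comment> \<open>Elements of \<open>N2\<close> must themselves be split along \<open>AA\<close>
    and \<open>D\<close>, since the factors of \<open>N3\<close> come from commutators with these
    two separately.\<close>
  have N2_comm: "commutator G n x \<in> N3"
    if n: "n \<in> N2" and x: "x \<in> carrier G"
      and AAx: "\<And>y. y \<in> AA \<Longrightarrow> commutator G y x \<in> N3"
      and Dx: "\<And>y. y \<in> D \<Longrightarrow> commutator G y x \<in> N3" for n x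
  proof -
    obtain y z where "n = y \<otimes> z" "y \<in> AA" "z \<in> D"
      using n by (auto simp: N2_def set_mult_def)
    then show ?thesis
      using AAx Dx x subgroup.mem_carrier[OF sAA] subgroup.mem_carrier[OF sD]
      by (simp add: commutator_mult_left_normal[OF N3])
  qed
  \<comment> \<open>By \<open>G2\<close> the product \<open>N2 <#> BB\<close> contains the second
    term of \<open>G\<close>, so this bound yields one for the third term by monotonicity.\<close>
  have "comm2 G (N2 <#> BB) (A <#> B) \<subseteq> N3 <#> BBB"
  proof (rule comm2_set_mult_subset[OF N3 sBBB])
    show "commutator G n a \<in> N3" if n: "n \<in> N2" and a: "a \<in> A" for n a
    proof (rule N2_comm[OF n])
      show "a \<in> carrier G" by (rule subsetD[OF Ac a])
      show "commutator G y a \<in> N3" if "y \<in> AA" for y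
        using commutator_in_comm2[OF that a] in_N3(1) by (auto simp: P1_def)
      show "commutator G y a \<in> N3" if "y \<in> D" for y
        using commutator_in_comm2[OF that a] in_N3(2) by (auto simp: P2_def)
    qed
    show "commutator G n b \<in> N3" if n: "n \<in> N2" and b: "b \<in> B" for n b
    proof (rule N2_comm[OF n])
      show "b \<in> carrier G" by (rule subsetD[OF Bc b])
      show "commutator G y b \<in> N3" if "y \<in> AA" for y
        using commutator_in_comm2[OF that b] in_N3(4) by (auto simp: P4_def)
      show "commutator G y b \<in> N3" if "y \<in> D" for y
        using commutator_in_comm2[OF that b] in_N3(5) by (auto simp: P5_def)
    qed
    show "commutator G c a \<in> N3" if "c \<in> BB" "a \<in> A" for c a
      using commutator_in_comm2[OF that] in_N3(3) by (auto simp: P3_def)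
    show "commutator G c b \<in> BBB" if "c \<in> BB" "b \<in> B" for c b
      using commutator_in_comm2[OF that] by (simp add: BBB_def)
  qed simp_all
  moreover have "?G3 \<subseteq> comm2 G (N2 <#> BB) (A <#> B)"
    unfolding comm3_def using G2 by (rule comm2_mono) (simp add: AB)
  ultimately have G3: "?G3 \<subseteq> N3 <#> BBB" by auto
  have 2: "internal_semidirect (G\<lparr>carrier := ?G3\<rparr>) N3 BBB"
    by (rule internal_semidirect_subgroup[OF assms(2) sG3 N3 sBBB N3A BBB_B N3G BBBG G3])

  have N2_eq: "lower_central G A 2 <#> comm2 G A B = N2"
    by (simp add: N2_def AA_def D_def lower_central_2)
  have N3_eq: "lower_central G A 3 <#> comm3 G A B A <#> comm3 G B B A
      <#> comm3 G A A B <#> comm3 G A B B = N3"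
    by (simp add: N3_def P1_def P2_def P3_def P4_def P5_def AA_def D_def BB_def
        lower_central_3 comm3_def)
  have BB_eq: "lower_central G B 2 = BB" and BBB_eq: "lower_central G B 3 = BBB"
    by (simp_all add: BB_def BBB_def lower_central_2 lower_central_3 comm3_def)
  show ?thesis
    unfolding N2_eq N3_eq BB_eq BBB_eq lower_central_2[of G "carrier G"]
      lower_central_3[of G "carrier G"] Let_def
    using 1 2 N2A N3A BB_B BBB_B by blast
qed

end
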